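(* Let $N\ge 2$ be an integer and let $\Omega\subset\mathbb{R}^d$ be a convex domain. If $u:\Omega\to\mathbb{R}^d$ is $N$-cyclically monotone on $\Omega$, then there exists a function of two variables $F:\Omega\times\Omega\to\mathbb{R}$, concave in the first variable and convex in the second, that is $N$-cyclically sub-antisymmetric and zero on the diagonal, such that $$(-u(x),u(x))\in\partial F(x,x)\quad\text{for all }x\in\Omega,$$ where $\partial F$ is the sub-differential of $F$ as a concave-convex function. Moreover, $$u(x)=\nabla_2F(x,x)\quad\text{for a.e. }x\in\Omega.$$
   Context: A domain is a nonempty open connected subset of $\mathbb{R}^d$; "a.e." refers to Lebesgue measure. A map $u:\Omega\to\mathbb{R}^d$ is $N$-cyclically monotone if for every cycle $x_1,\dots,x_N,x_{N+1}=x_1$ of points in $\Omega$ one has $\sum_{i=1}^N\langle u(x_i),x_i-x_{i+1}\rangle\ge0$. A function $F$ of two variables on $\Omega\times\Omega$ is $N$-cyclically sub-antisymmetric on $\Omega$ if $F(x,x)=0$ for all $x\in\Omega$ and $\sum_{i=1}^NF(x_i,x_{i+1})\le0$ for all cyclic families $x_1,\dots,x_N,x_{N+1}=x_1$ in $\Omega$. For a concave-convex function $F$, the sub-differential $\partial F(x,y)$ is the set of pairs $(p,q)\in\mathbb{R}^d\times\mathbb{R}^d$ such that $F(x',y)\le F(x,y)+\langle p,x'-x\rangle$ for all $x'\in\Omega$ and $F(x,y')\ge F(x,y)+\langle q,y'-y\rangle$ for all $y'\in\Omega$. $\nabla_2F(x,x)$ denotes the gradient of $y\mapsto F(x,y)$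 at $y=x$. *)

theory Defs
  imports "HOL-Analysis.Analysis"
begin

definition cyclically_monotone_on :: "nat \<Rightarrow> 'a::real_inner set \<Rightarrow> ('a \<Rightarrow> 'a) \<Rightarrow> bool" where
  "cyclically_monotone_on N \<Omega> u \<longleftrightarrow>
     (\<forall>x :: nat \<Rightarrow> 'a. (\<forall>i\<in>{1..N}. x i \<in> \<Omega>) \<and> x (N + 1) = x 1 \<longrightarrow>
        (\<Sum>i = 1..N. u (x i) \<bullet> (x i - x (i + 1))) \<ge> 0)"

definition cyclically_sub_antisymmetric_on :: "nat \<Rightarrow> 'a set \<Rightarrow> ('a \<Rightarrow> 'a \<Rightarrow> real) \<Rightarrow> bool" where
  "cyclically_sub_antisymmetric_on N \<Omega> F \<longleftrightarrow>
     (\<forall>x\<in>\<Omega>. F x x = 0) \<and>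
     (\<forall>x :: nat \<Rightarrow> 'a. (\<forall>i\<in>{1..N}. x i \<in> \<Omega>) \<and> x (N + 1) = x 1 \<longrightarrow>
        (\<Sum>i = 1..N. F (x i) (x (i + 1))) \<le> 0)"

definition concave_convex_on :: "'a::real_vector set \<Rightarrow> ('a \<Rightarrow> 'a \<Rightarrow> real) \<Rightarrow> bool" where
  "concave_convex_on \<Omega> F \<longleftrightarrow>
     (\<forall>y\<in>\<Omega>. concave_on \<Omega> (\<lambda>x. F x y)) \<and> (\<forall>x\<in>\<Omega>. convex_on \<Omega> (\<lambda>y. F x y))"

text \<open>The first component is a supergradient of the concave map \<open>F \<cdot> y\<close>, the second a
  subgradient of the convex map \<open>F x \<cdot>\<close>; both inequalities are tested only on \<open>\<Omega>\<close>, so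
  values of \<open>F\<close> outside \<open>\<Omega> \<times> \<Omega>\<close> play no role.\<close>

definition saddle_subdifferential ::
    "'a::real_inner set \<Rightarrow> ('a \<Rightarrow> 'a \<Rightarrow> real) \<Rightarrow> 'a \<Rightarrow> 'a \<Rightarrow> ('a \<times> 'a) set" where
  "saddle_subdifferential \<Omega> F x y =
     {(p, q). (\<forall>x'\<in>\<Omega>. F x' y \<le> F x y + p \<bullet> (x' - x)) \<and>
              (\<forall>y'\<in>\<Omega>. F x y' \<ge> F x y + q \<bullet> (y' - y))}"

end

theory Submission
  imports Defs
begin

text \<open>
  The \<open>N\<close>-cyclic monotonicity of \<open>u\<close> says exactly that \<open>f x y = u x \<bullet> (y - x)\<close> is \<open>N\<close>-cyclically
  sub-antisymmetric. This \<open>f\<close> vanishes on the diagonal and is affine in \<open>y\<close>, but it need not be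
  concave in \<open>x\<close>. The function \<open>F\<close> is its concave hull in \<open>x\<close>: the supremum of
  \<open>\<Sum>k. l k * f (x k) y\<close> over all convex combinations \<open>x = \<Sum>k. l k *\<^sub>R x k\<close>. As a supremum of
  affine functions of \<open>y\<close> it is still convex in \<open>y\<close>.

  Sub-antisymmetry survives because \<open>f\<close> is affine in its second argument: each \<open>x i\<close> in a cycle
  can be replaced by its convex combination in both places where it occurs, so the cyclic sum for
  \<open>F\<close> is approximated by averages of cyclic sums for \<open>f\<close>
  (\<open>cyclic_sum_nonpos_convex_hull\<close>). The cycle \<open>x, y, \<dots>, y\<close> shows that \<open>u\<close> is monotone, and
  this gives the sandwich
  \<open>u x \<bullet> (y - x) \<le> F x y \<le> u y \<bullet> (y - x)\<close>
  (\<open>saddle_hull_bounds\<close>). It makes \<open>F\<close> finite and zero on the diagonal, and it contains both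
  subgradient inequalities at diagonal points.

  The sandwich also controls the gradient: \<open>F x\<close> has partial derivative \<open>u x \<bullet> b\<close> at \<open>x\<close> as soon
  as \<open>t \<mapsto> u (x + t *\<^sub>R b) \<bullet> b\<close> is continuous at \<open>0\<close>, and for a convex function partial derivatives
  along a basis already give differentiability
  (\<open>convex_has_derivative_of_coordinate_bounds\<close>). On each line parallel to \<open>b\<close> the function
  \<open>u \<bullet> b\<close> is increasing, so it has only countably many discontinuities; Fubini's theorem then makes
  the set of bad points null, once this set is known to be Borel
  (\<open>monotone_operator_continuous_along_line_AE\<close>).
\<close>

section \<open>Cyclic inequalities pass to convex hulls\<close>

text \<open>When all points of the cycle but one are held fixed, the sum is an affine function of the
  remaining point, so the points at which it is nonpositive form a convex set. A convex set
  containing \<open>G\<close> contains its hull; hence the points of the cycle can be moved from \<open>G\<close> into the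
  hull one after the other. The condition \<open>s i \<noteq> i\<close> keeps the summands from becoming quadratic.\<close>

lemma cyclic_sum_nonpos_convex_hull:
  fixes B :: "'b::real_vector \<Rightarrow> 'b \<Rightarrow> real" and G :: "'b set"
  assumes "finite I" and s: "\<And>i. i \<in> I \<Longrightarrow> s i \<noteq> i"
    and affine1: "\<And>a b v w z. a + b = 1 \<Longrightarrow> B (a *\<^sub>R v + b *\<^sub>R w) z = a * B v z + b * B w z"
    and affine2: "\<And>a b v w z. a + b = 1 \<Longrightarrow> B z (a *\<^sub>R v + b *\<^sub>R w) = a * B z v + b * B z w"
    and base: "\<And>z. (\<And>i. i \<in> I \<Longrightarrow> z i \<in> G) \<Longrightarrow> (\<Sum>i\<in>I. B (z i) (z (s i))) \<le> 0"
    and z: "\<And>i. i \<in> I \<Longrightarrow> z i \<in> convex hull G"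
  shows "(\<Sum>i\<in>I. B (z i) (z (s i))) \<le> 0"
proof -
  define S where "S z = (\<Sum>i\<in>I. B (z i) (z (s i)))" for z
  have S_affine: "S (z(k := a *\<^sub>R v + b *\<^sub>R w)) = a * S (z(k := v)) + b * S (z(k := w))"
    if ab: "a + b = 1" for z k a b v w
  proof -
    have const: "a * c + b * c = c" for c :: real
      using ab by (simp flip: distrib_right)
    \<comment> \<open>As \<open>s i \<noteq> i\<close>, the varied point enters at most one argument of each summand.\<close>
    have "B ((z(k := a *\<^sub>R v + b *\<^sub>R w)) i) ((z(k := a *\<^sub>R v + b *\<^sub>R w)) (s i))
        = a * B ((z(k := v)) i) ((z(k := v)) (s i)) + b * B ((z(k := w)) i) ((z(k := w)) (s i))"
      if "i \<in> I" for i
      using s[OF that] by (auto simp: affine1[OF ab] affine2[OF ab] const)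
    then show ?thesis
      by (simp add: S_def sum_distrib_left sum.distrib)
  qed
  \<comment> \<open>The indices in \<open>J\<close> are those whose points have already been moved into the hull.\<close>
  have partial: "S z \<le> 0"
    if "finite J" "J \<subseteq> I" "\<And>i. i \<in> J \<Longrightarrow> z i \<in> convex hull G" "\<And>i. i \<in> I - J \<Longrightarrow> z i \<in> G" for J z
    using that
  proof (induction J arbitrary: z rule: finite_induct)
    case empty
    then show ?case using base[of z] by (simp add: S_def)
  next
    case (insert k J)
    let ?C = "{w. S (z(k := w)) \<le> 0}"
    have "convex ?C"
      unfolding convex_def
    proof (clarify)
      fix v w and a b :: real
      assume *: "S (z(k := v)) \<le> 0" "S (z(k := w)) \<le> 0" "0 \<le> a" "0 \<le> b" "a + b = 1"
      then show "S (z(k := a *\<^sub>R v + b *\<^sub>R w)) \<le> 0"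
        using S_affine[of a b z k v w] mult_nonneg_nonpos[of a] mult_nonneg_nonpos[of b]
        by (simp add: add_nonpos_nonpos)
    qed
    moreover have "G \<subseteq> ?C"
    proof
      fix w assume "w \<in> G"
      have "S (z(k := w)) \<le> 0"
      proof (rule insert.IH)
        show "(z(k := w)) i \<in> convex hull G" if "i \<in> J" for i
          using insert that by auto
        show "(z(k := w)) i \<in> G" if "i \<in> I - J" for i
          using insert.prems that \<open>w \<in> G\<close> by auto
      qed (use insert.prems in auto)
      then show "w \<in> ?C" by simp
    qed
    ultimately have "convex hull G \<subseteq> ?C"
      by (rule hull_minimal[rotated])
    then show ?case
      using insert.prems(2)[of k] by auto
  qed
  show ?thesis
    using partial[of I z] \<open>finite I\<close> z by (simp add: S_def)
qed

section \<open>Monotone maps\<close>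

definition monotone_operator_on :: "'a::real_inner set \<Rightarrow> ('a \<Rightarrow> 'a) \<Rightarrow> bool" where
  "monotone_operator_on \<Omega> u \<longleftrightarrow> (\<forall>x\<in>\<Omega>. \<forall>y\<in>\<Omega>. (u x - u y) \<bullet> (x - y) \<ge> 0)"

lemma monotone_operator_onD:
  assumes "monotone_operator_on \<Omega> u" "x \<in> \<Omega>" "y \<in> \<Omega>"
  shows "(u x - u y) \<bullet> (x - y) \<ge> 0"
  using assms by (auto simp: monotone_operator_on_def)

lemma cyclically_monotone_imp_monotone_operator:
  assumes "N \<ge> 2" and cyc: "cyclically_monotone_on N \<Omega> u"
  shows "monotone_operator_on \<Omega> u"
  unfolding monotone_operator_on_def
proof (intro ballI)
  fix x y assume "x \<in> \<Omega>" "y \<in> \<Omega>"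
  \<comment> \<open>In the cycle \<open>x, y, \<dots>, y\<close> only the first and the last step are nontrivial.\<close>
  define z where "z i = (if i = 1 \<or> i = N + 1 then x else y)" for i
  have "(\<Sum>i = 1..N. u (z i) \<bullet> (z i - z (i + 1))) \<ge> 0"
  proof -
    have "\<forall>i\<in>{1..N}. z i \<in> \<Omega>" "z (N + 1) = z 1"
      using \<open>x \<in> \<Omega>\<close> \<open>y \<in> \<Omega>\<close> by (auto simp: z_def)
    then show ?thesis
      using cyc unfolding cyclically_monotone_on_def by blast
  qed
  also have "(\<Sum>i = 1..N. u (z i) \<bullet> (z i - z (i + 1))) = (\<Sum>i \<in> {1, N}. u (z i) \<bullet> (z i - z (i + 1)))"
    by (rule sum.mono_neutral_right) (use \<open>N \<ge> 2\<close> in \<open>auto simp: z_def\<close>)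
  also have "\<dots> = u x \<bullet> (x - y) + u y \<bullet> (y - x)"
    using \<open>N \<ge> 2\<close> by (simp add: z_def)
  also have "\<dots> = (u x - u y) \<bullet> (x - y)"
    by (simp add: algebra_simps)
  finally show "(u x - u y) \<bullet> (x - y) \<ge> 0" .
qed

text \<open>Monotonicity between \<open>y\<close> and the vertices \<open>w = x + r *\<^sub>R v\<close> of a cross-polytope around \<open>x\<close>
  bounds every \<open>u y \<bullet> (w - y)\<close> by a constant that depends only on the finitely many values \<open>u w\<close>.
  For \<open>y\<close> close to \<open>x\<close>, the vectors \<open>w - y\<close> point in all coordinate directions up to a small error,
  which can be absorbed into \<open>norm (u y)\<close>.\<close>

lemma monotone_operator_locally_bounded:
  fixes u :: "'a::euclidean_space \<Rightarrow> 'a"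
  assumes mono: "monotone_operator_on \<Omega> u" and "open \<Omega>" "x \<in> \<Omega>"
  obtains r K where "r > 0" "ball x r \<subseteq> \<Omega>" "\<And>y. y \<in> ball x r \<Longrightarrow> norm (u y) \<le> K"
proof -
  obtain r where "r > 0" and r: "cball x r \<subseteq> \<Omega>"
    using \<open>open \<Omega>\<close> \<open>x \<in> \<Omega>\<close> open_contains_cball by blast
  define V :: "'a set" where "V = Basis \<union> uminus ` Basis"
  define C where "C = (\<Sum>v\<in>V. norm (u (x + r *\<^sub>R v)) * (2 * r))"
  define d where "d = real DIM('a)"
  have "d \<ge> 1"
    using DIM_positive[where 'a='a] by (simp add: d_def Suc_le_eq)
  have "finite V" by (simp add: V_def)
  have normV: "norm v = 1" if "v \<in> V" for v
    using that by (auto simp: V_def)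
  have test: "r * (u y \<bullet> v) \<le> C + norm (u y) * norm (y - x)" if "v \<in> V" "y \<in> ball x r" for v y
  proof -
    define w where "w = x + r *\<^sub>R v"
    have "w \<in> \<Omega>" "y \<in> \<Omega>"
      using r that normV \<open>r > 0\<close> by (auto simp: w_def dist_norm subset_iff)
    have "norm (w - y) \<le> norm (w - x) + norm (x - y)"
      using norm_triangle_ineq[of "w - x" "x - y"] by simp
    also have "\<dots> \<le> 2 * r"
      using that normV \<open>r > 0\<close> by (simp add: w_def dist_norm)
    finally have "u w \<bullet> (w - y) \<le> norm (u w) * (2 * r)"
      by (meson mult_left_mono norm_cauchy_schwarz norm_ge_zero order_trans)
    also have "\<dots> \<le> C"
      unfolding C_def w_def using \<open>finite V\<close> that \<open>r > 0\<close> by (intro member_le_sum) auto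
    finally have "u w \<bullet> (w - y) \<le> C" .
    moreover have "u y \<bullet> (w - y) \<le> u w \<bullet> (w - y)"
      using monotone_operator_onD[OF mono \<open>w \<in> \<Omega>\<close> \<open>y \<in> \<Omega>\<close>] by (simp add: inner_diff_left)
    moreover have "u y \<bullet> (w - y) = r * (u y \<bullet> v) - u y \<bullet> (y - x)"
      by (simp add: w_def algebra_simps)
    moreover have "u y \<bullet> (y - x) \<le> norm (u y) * norm (y - x)"
      by (rule norm_cauchy_schwarz)
    ultimately show ?thesis by linarith
  qed
  show ?thesis
  proof
    \<comment> \<open>Adding \<open>test\<close> over the \<open>d\<close> coordinates bounds \<open>r * norm (u y)\<close> up to the error
      \<open>norm (u y) * (d * norm (y - x))\<close>; this radius makes the error at most half of the left side.\<close>
    show "r / (2 * d) > 0" using \<open>r > 0\<close> \<open>d \<ge> 1\<close> by simp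
    have le: "r / (2 * d) \<le> r"
      using \<open>r > 0\<close> \<open>d \<ge> 1\<close> by (simp add: field_simps)
    show "ball x (r / (2 * d)) \<subseteq> \<Omega>"
      using le r by (force simp: subset_iff)
    fix y assume y: "y \<in> ball x (r / (2 * d))"
    have "y \<in> ball x r" using y le by auto
    have "r * norm (u y) \<le> r * (\<Sum>b\<in>Basis. \<bar>u y \<bullet> b\<bar>)"
      using \<open>r > 0\<close> norm_le_l1[of "u y"] by simp
    also have "\<dots> = (\<Sum>b\<in>Basis. r * \<bar>u y \<bullet> b\<bar>)"
      by (simp add: sum_distrib_left)
    also have "\<dots> \<le> (\<Sum>b\<in>(Basis::'a set). C + norm (u y) * norm (y - x))"
    proof (rule sum_mono)
      fix b :: 'a assume "b \<in> Basis"
      then show "r * \<bar>u y \<bullet> b\<bar> \<le> C + norm (u y) * norm (y - x)"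
        using test[of b y] test[of "- b" y] \<open>y \<in> ball x r\<close>
        by (auto simp: V_def abs_if)
    qed
    also have "\<dots> = d * C + norm (u y) * (d * norm (y - x))"
      by (simp add: d_def algebra_simps)
    also have "\<dots> \<le> d * C + norm (u y) * (r / 2)"
    proof -
      have "d * norm (y - x) \<le> r / 2"
        using y \<open>d \<ge> 1\<close> by (simp add: dist_norm norm_minus_commute field_simps)
      then show ?thesis by (intro add_left_mono mult_left_mono) auto
    qed
    finally show "norm (u y) \<le> 2 * d * C / r"
      using \<open>r > 0\<close> by (simp add: field_simps)
  qed
qed

text \<open>For \<open>y = x\<close> this would be monotonicity along the line through \<open>x\<close>. For \<open>y\<close> near \<open>x\<close>, the vector
  from \<open>y\<close> to \<open>x + t *\<^sub>R e\<close> is off by \<open>x - y\<close>, whose effect tends to zero because \<open>u\<close> is bounded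
  near \<open>x\<close>. The step \<open>t > 0\<close> cannot be dropped, since \<open>u\<close> may be discontinuous at \<open>x\<close>.\<close>

lemma monotone_operator_upper_semicontinuous_along:
  fixes u :: "'a::euclidean_space \<Rightarrow> 'a"
  assumes mono: "monotone_operator_on \<Omega> u" and "open \<Omega>" "x \<in> \<Omega>" "x + t *\<^sub>R e \<in> \<Omega>" "t > 0" "\<epsilon> > 0"
  shows "\<forall>\<^sub>F y in nhds x. u y \<bullet> e < u (x + t *\<^sub>R e) \<bullet> e + \<epsilon>"
proof -
  define a where "a = x + t *\<^sub>R e"
  obtain r K where r: "r > 0" "ball x r \<subseteq> \<Omega>" "\<And>y. y \<in> ball x r \<Longrightarrow> norm (u y) \<le> K"
    using monotone_operator_locally_bounded[OF mono \<open>open \<Omega>\<close> \<open>x \<in> \<Omega>\<close>] by blast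
  define L where "L = norm (u a) + \<bar>K\<bar> + 1"
  have "L > 0" by (simp add: L_def add_nonneg_pos)
  have "u y \<bullet> e < u a \<bullet> e + \<epsilon>" if y: "dist y x < min r (t * \<epsilon> / L)" for y
  proof -
    have "y \<in> ball x r" using y by (simp add: dist_commute)
    then have "norm (u y) \<le> K" "y \<in> \<Omega>" using r by auto
    have "0 \<le> (u a - u y) \<bullet> (a - y)"
      using monotone_operator_onD[OF mono] \<open>y \<in> \<Omega>\<close> assms by (simp add: a_def)
    also have "\<dots> = t * ((u a - u y) \<bullet> e) + (u a - u y) \<bullet> (x - y)"
      by (simp add: a_def algebra_simps)
    also have "(u a - u y) \<bullet> (x - y) \<le> norm (u a - u y) * norm (x - y)"
      by (rule norm_cauchy_schwarz)
    also have "\<dots> \<le> L * norm (x - y)"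
      using \<open>norm (u y) \<le> K\<close> norm_triangle_ineq4[of "u a" "u y"]
      by (intro mult_right_mono) (auto simp: L_def)
    also have "\<dots> < t * \<epsilon>"
      using y \<open>L > 0\<close> by (simp add: dist_norm norm_minus_commute field_simps)
    finally have "t * ((u a - u y) \<bullet> e + \<epsilon>) > 0"
      by (simp add: algebra_simps)
    then show ?thesis
      using \<open>t > 0\<close> by (simp add: zero_less_mult_iff inner_diff_left)
  qed
  then show ?thesis
    unfolding eventually_nhds_metric a_def[symmetric]
    using r(1) \<open>t > 0\<close> \<open>\<epsilon> > 0\<close> \<open>L > 0\<close> by (intro exI[of _ "min r (t * \<epsilon> / L)"]) auto
qed

lemma monotone_operator_mono_along:
  assumes mono: "monotone_operator_on \<Omega> u" and "x + s *\<^sub>R e \<in> \<Omega>" "x + t *\<^sub>R e \<in> \<Omega>" "s \<le> t"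
  shows "u (x + s *\<^sub>R e) \<bullet> e \<le> u (x + t *\<^sub>R e) \<bullet> e"
proof (cases "s = t")
  case False
  have "0 \<le> (u (x + t *\<^sub>R e) - u (x + s *\<^sub>R e)) \<bullet> ((x + t *\<^sub>R e) - (x + s *\<^sub>R e))"
    using monotone_operator_onD[OF mono] assms by blast
  also have "\<dots> = (t - s) * (u (x + t *\<^sub>R e) \<bullet> e - u (x + s *\<^sub>R e) \<bullet> e)"
    by (simp add: algebra_simps)
  finally show ?thesis
    using False \<open>s \<le> t\<close> by (simp add: zero_le_mult_iff)
qed simp

section \<open>Continuity of monotone maps along lines, almost everywhere\<close>

text \<open>Translation invariance replaces a choice of coordinates adapted to \<open>e\<close>: averaging the measure
  of the translates \<open>S - t *\<^sub>R e\<close> over \<open>t\<close> in \<open>{0..1}\<close> gives back the measure of \<open>S\<close>, and exchanging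
  the two integrals turns the average into an integral of one-dimensional measures of line
  sections.\<close>

lemma null_set_of_countable_line_sections:
  fixes S :: "'a::euclidean_space set"
  assumes S [measurable]: "S \<in> sets borel" and "\<And>x. countable {t. x + t *\<^sub>R e \<in> S}"
  shows "S \<in> null_sets lborel"
proof -
  have [measurable]: "(\<lambda>(x :: 'a, t :: real). x + t *\<^sub>R e) \<in> lborel \<Otimes>\<^sub>M lborel \<rightarrow>\<^sub>M borel"
    by measurable
  have shift: "(\<integral>\<^sup>+x. indicator S (x + t *\<^sub>R e) \<partial>lborel) = emeasure lborel S" for t
  proof -
    have "emeasure lborel S = (\<integral>\<^sup>+x. indicator S x \<partial>distr lborel borel ((+) (t *\<^sub>R e)))"
      by (simp add: lborel_distr_plus)
    also have "\<dots> = (\<integral>\<^sup>+x. indicator S (t *\<^sub>R e + x) \<partial>lborel)"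
      by (rule nn_integral_distr) auto
    finally show ?thesis by (simp add: add.commute)
  qed
  have line: "(\<integral>\<^sup>+t. indicator {0..1::real} t * indicator S (x + t *\<^sub>R e) \<partial>lborel) = (0::ennreal)" for x
  proof -
    have "AE t in lborel. t \<notin> {t. x + t *\<^sub>R e \<in> S}"
      using assms(2) by (intro AE_not_in countable_imp_null_set_lborel)
    then have "AE t in lborel. indicator {0..1::real} t * indicator S (x + t *\<^sub>R e) = (0::ennreal)"
      by eventually_elim auto
    then show ?thesis
      by (subst nn_integral_cong_AE[where v = "\<lambda>_. 0"]) auto
  qed
  have "emeasure lborel S = (\<integral>\<^sup>+t. indicator {0..1::real} t * emeasure lborel S \<partial>lborel)"
    by (simp add: nn_integral_multc)
  also have "\<dots> = (\<integral>\<^sup>+t. (\<integral>\<^sup>+x. indicator {0..1::real} t * indicator S (x + t *\<^sub>R e) \<partial>lborel) \<partial>lborel)"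
    by (simp add: nn_integral_cmult shift)
  also have "\<dots> = (\<integral>\<^sup>+x. (\<integral>\<^sup>+t. indicator {0..1::real} t * indicator S (x + t *\<^sub>R e) \<partial>lborel) \<partial>lborel)"
    by (rule lborel_pair.Fubini') measurable
  also have "\<dots> = 0"
    by (simp add: line)
  finally show ?thesis
    using S by (simp add: null_sets_def)
qed

text \<open>A point of \<open>\<Omega>\<close> is good if the increments of \<open>u \<bullet> e\<close> over short segments centred at it become
  arbitrarily small; by monotonicity along the line this is continuity in the direction \<open>e\<close>. The
  map \<open>u\<close> is not assumed to be measurable, so measurability of the set of good points must come from
  monotonicity: the condition \<open>G n\<close> below, which allows some increment below \<open>1 / Suc n\<close>, is open.\<close>

lemma monotone_operator_continuous_along_line_AE:
  fixes u :: "'a::euclidean_space \<Rightarrow> 'a"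
  assumes mono: "monotone_operator_on \<Omega> u" and "open \<Omega>" "convex \<Omega>"
  shows "AE x in lborel. x \<in> \<Omega> \<longrightarrow> isCont (\<lambda>t. u (x + t *\<^sub>R e) \<bullet> e) 0"
proof -
  define G where "G n = {x\<in>\<Omega>. \<exists>t>0. x + t *\<^sub>R e \<in> \<Omega> \<and> x - t *\<^sub>R e \<in> \<Omega> \<and>
      u (x + t *\<^sub>R e) \<bullet> e - u (x - t *\<^sub>R e) \<bullet> e < 1 / real (Suc n)}" for n
  define D where "D = \<Omega> - (\<Inter>n. G n)"
  have contI: "isCont (\<lambda>t. u (x + t *\<^sub>R e) \<bullet> e) 0" if x: "x \<in> \<Omega>" and G: "\<And>n. x \<in> G n" for x
    unfolding continuous_at_eps_delta
  proof (intro allI impI)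
    fix \<epsilon> :: real assume "\<epsilon> > 0"
    then obtain n where n: "1 / real (Suc n) < \<epsilon>"
      using nat_approx_posE by blast
    obtain t where t: "t > 0" "x + t *\<^sub>R e \<in> \<Omega>" "x - t *\<^sub>R e \<in> \<Omega>"
      "u (x + t *\<^sub>R e) \<bullet> e - u (x - t *\<^sub>R e) \<bullet> e < 1 / real (Suc n)"
      using G[of n] by (auto simp: G_def)
    have "\<bar>u (x + s *\<^sub>R e) \<bullet> e - u x \<bullet> e\<bar> < \<epsilon>" if "\<bar>s\<bar> < t" for s
    proof -
      have inO: "x + s *\<^sub>R e \<in> \<Omega>"
      proof -
        have "x + s *\<^sub>R e = ((t - s) / (2 * t)) *\<^sub>R (x - t *\<^sub>R e) + ((t + s) / (2 * t)) *\<^sub>R (x + t *\<^sub>R e)"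
        proof -
          have "((t - s) / (2 * t)) *\<^sub>R (x - t *\<^sub>R e) + ((t + s) / (2 * t)) *\<^sub>R (x + t *\<^sub>R e)
             = ((t - s) / (2 * t) + (t + s) / (2 * t)) *\<^sub>R x
               + (((t + s) / (2 * t) - (t - s) / (2 * t)) * t) *\<^sub>R e"
            by (simp add: algebra_simps)
          also have "(t - s) / (2 * t) + (t + s) / (2 * t) = 1"
            using t(1) by (simp add: field_simps)
          also have "((t + s) / (2 * t) - (t - s) / (2 * t)) * t = s"
            using t(1) by (simp add: field_simps)
          finally show ?thesis by simp
        qed
        moreover have "\<dots> \<in> \<Omega>"
          using t that by (intro convexD[OF \<open>convex \<Omega>\<close>]) (auto simp: field_simps)
        ultimately show ?thesis by simp
      qed
      have "u (x + (-t) *\<^sub>R e) \<bullet> e \<le> u (x + s *\<^sub>R e) \<bullet> e" "u (x + s *\<^sub>R e) \<bullet> e \<le> u (x + t *\<^sub>R e) \<bullet> e"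
        "u (x + (-t) *\<^sub>R e) \<bullet> e \<le> u (x + 0 *\<^sub>R e) \<bullet> e" "u (x + 0 *\<^sub>R e) \<bullet> e \<le> u (x + t *\<^sub>R e) \<bullet> e"
        by (rule monotone_operator_mono_along[OF mono]; use t that inO x in simp)+
      then show ?thesis using t n by simp
    qed
    then show "\<exists>d>0. \<forall>s. dist s 0 < d \<longrightarrow> dist (u (x + s *\<^sub>R e) \<bullet> e) (u (x + 0 *\<^sub>R e) \<bullet> e) < \<epsilon>"
      using t(1) by (intro exI[of _ t]) (simp add: dist_real_def)
  qed
  have open_G: "open (G n)" for n
    unfolding open_subopen[of "G n"]
  proof
    fix x assume "x \<in> G n"
    then obtain t where x: "x \<in> \<Omega>" and t: "t > 0" "x + t *\<^sub>R e \<in> \<Omega>" "x - t *\<^sub>R e \<in> \<Omega>"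
      "u (x + t *\<^sub>R e) \<bullet> e - u (x - t *\<^sub>R e) \<bullet> e < 1 / real (Suc n)"
      by (auto simp: G_def)
    define \<epsilon> where "\<epsilon> = (1 / real (Suc n) - (u (x + t *\<^sub>R e) \<bullet> e - u (x - t *\<^sub>R e) \<bullet> e)) / 2"
    have "\<epsilon> > 0" using t by (simp add: \<epsilon>_def)
    \<comment> \<open>Passing from the half-length \<open>t/2\<close> at \<open>y\<close> to the full length \<open>t\<close> at \<open>x\<close> leaves the positive
      step that semicontinuity along the direction requires. The directions \<open>e\<close> and \<open>- e\<close> treat
      the two ends of the segment.\<close>
    have half: "\<forall>\<^sub>F y in nhds x. y + (t/2) *\<^sub>R v \<in> \<Omega> \<and>
        u (y + (t/2) *\<^sub>R v) \<bullet> v < u (x + t *\<^sub>R v) \<bullet> v + \<epsilon>" if v: "x + t *\<^sub>R v \<in> \<Omega>" for v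
    proof -
      define m where "m = x + (t/2) *\<^sub>R v"
      have "m = (1/2) *\<^sub>R x + (1/2) *\<^sub>R (x + t *\<^sub>R v)"
        by (simp add: m_def algebra_simps flip: scaleR_left.add)
      then have "m \<in> \<Omega>"
        using convexD[OF \<open>convex \<Omega>\<close> x v, of "1/2" "1/2"] by simp
      have me: "m + (t/2) *\<^sub>R v = x + t *\<^sub>R v"
        by (simp add: m_def add.assoc flip: scaleR_left.add)
      have "\<forall>\<^sub>F y in nhds m. u y \<bullet> v < u (x + t *\<^sub>R v) \<bullet> v + \<epsilon>"
        using monotone_operator_upper_semicontinuous_along[OF mono \<open>open \<Omega>\<close> \<open>m \<in> \<Omega>\<close>, of "t/2" v \<epsilon>]
          t(1) v \<open>\<epsilon> > 0\<close> by (simp add: me)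
      moreover have "\<forall>\<^sub>F y in nhds m. y \<in> \<Omega>"
        using \<open>m \<in> \<Omega>\<close> \<open>open \<Omega>\<close> by (rule eventually_nhds_in_open[rotated])
      ultimately have "\<forall>\<^sub>F y in nhds m. y \<in> \<Omega> \<and> u y \<bullet> v < u (x + t *\<^sub>R v) \<bullet> v + \<epsilon>"
        by eventually_elim simp
      moreover have "((\<lambda>y. y + (t/2) *\<^sub>R v) \<longlongrightarrow> m) (nhds x)"
        unfolding m_def by (intro tendsto_intros filterlim_ident)
      ultimately show ?thesis
        by (rule eventually_compose_filterlim)
    qed
    have up: "\<forall>\<^sub>F y in nhds x. y + (t/2) *\<^sub>R e \<in> \<Omega> \<and>
        u (y + (t/2) *\<^sub>R e) \<bullet> e < u (x + t *\<^sub>R e) \<bullet> e + \<epsilon>"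
      using half[of e] t(2) by simp
    have low: "\<forall>\<^sub>F y in nhds x. y - (t/2) *\<^sub>R e \<in> \<Omega> \<and>
        u (x - t *\<^sub>R e) \<bullet> e - \<epsilon> < u (y - (t/2) *\<^sub>R e) \<bullet> e"
      using half[of "- e"] t(3) by (simp add: algebra_simps)
    have "\<forall>\<^sub>F y in nhds x. y \<in> \<Omega>"
      using x \<open>open \<Omega>\<close> by (rule eventually_nhds_in_open[rotated])
    with up low have "\<forall>\<^sub>F y in nhds x. y \<in> G n"
    proof eventually_elim
      case (elim y)
      then have "u (y + (t/2) *\<^sub>R e) \<bullet> e - u (y - (t/2) *\<^sub>R e) \<bullet> e < 1 / real (Suc n)"
        by (simp add: \<epsilon>_def field_simps)
      then show ?case
        unfolding G_def using elim t(1) by (auto intro!: exI[of _ "t/2"])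
    qed
    then show "\<exists>T. open T \<and> x \<in> T \<and> T \<subseteq> G n"
      by (auto simp: eventually_nhds)
  qed
  have "D \<in> sets borel"
    unfolding D_def using open_G \<open>open \<Omega>\<close> by (intro sets.Diff sets.countable_INT) auto
  moreover have "countable {t. x + t *\<^sub>R e \<in> D}" for x
  proof -
    define I where "I = {t. x + t *\<^sub>R e \<in> \<Omega>}"
    define g where "g t = u (x + t *\<^sub>R e) \<bullet> e" for t
    have "open I"
    proof -
      have "I = (\<lambda>t. x + t *\<^sub>R e) -` \<Omega>" by (auto simp: I_def)
      then show ?thesis
        using \<open>open \<Omega>\<close> by (simp add: open_vimage continuous_intros)
    qed
    moreover have "mono_on I g"
      unfolding mono_on_def g_def I_def using monotone_operator_mono_along[OF mono] by auto
    ultimately have "countable {t\<in>I. \<not> isCont g t}"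
      by (rule mono_on_ctble_discont_open)
    moreover have "{t. x + t *\<^sub>R e \<in> D} \<subseteq> {t\<in>I. \<not> isCont g t}"
    proof (clarify, rule conjI)
      fix t assume D: "x + t *\<^sub>R e \<in> D"
      then show "t \<in> I" by (simp add: D_def I_def)
      show "\<not> isCont g t"
      proof
        assume "isCont g t"
        have "x + t *\<^sub>R e \<in> G n" for n
        proof -
          have plus: "((\<lambda>s. t + s) \<longlongrightarrow> t) (at_right 0)" and minus: "((\<lambda>s. t - s) \<longlongrightarrow> t) (at_right 0)"
            by (rule tendsto_eq_intros refl | simp)+
          have "((\<lambda>s. g (t + s) - g (t - s)) \<longlongrightarrow> g t - g t) (at_right 0)"
            by (intro tendsto_diff isCont_tendsto_compose[OF \<open>isCont g t\<close>] plus minus)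
          then have "\<forall>\<^sub>F s in at_right 0. g (t + s) - g (t - s) < 1 / real (Suc n)"
            by (rule order_tendstoD) simp
          moreover have "\<forall>\<^sub>F s in at_right 0. t + s \<in> I" "\<forall>\<^sub>F s in at_right 0. t - s \<in> I"
            using topological_tendstoD[OF plus \<open>open I\<close> \<open>t \<in> I\<close>]
              topological_tendstoD[OF minus \<open>open I\<close> \<open>t \<in> I\<close>] .
          moreover have "\<forall>\<^sub>F s in at_right 0. s > (0::real)"
            by (rule eventually_at_right_less)
          ultimately have "\<forall>\<^sub>F s in at_right (0::real). x + t *\<^sub>R e \<in> G n"
          proof eventually_elim
            case (elim s)
            then show ?case
              using \<open>t \<in> I\<close> unfolding G_def I_def g_def
              by (auto intro!: exI[of _ s] simp: scaleR_add_left scaleR_diff_left algebra_simps)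
          qed
          then show ?thesis by simp
        qed
        then show False using D by (simp add: D_def)
      qed
    qed
    ultimately show ?thesis
      by (rule countable_subset[rotated])
  qed
  ultimately have "D \<in> null_sets lborel"
    by (rule null_set_of_countable_line_sections)
  then have "AE x in lborel. x \<notin> D"
    by (rule AE_not_in)
  then show ?thesis
    by eventually_elim (use contI in \<open>auto simp: D_def\<close>)
qed

section \<open>Differentiability of convex functions from the coordinate directions\<close>

text \<open>The affine minorant with slope \<open>g\<close> gives one half of differentiability. For the other half,
  \<open>x + h\<close> is the average of the points \<open>x + (d * (h \<bullet> b)) *\<^sub>R b\<close> over the \<open>d\<close> basis vectors \<open>b\<close>, and
  convexity bounds \<open>f (x + h)\<close> by the average of the values there.\<close>

lemma convex_has_derivative_of_coordinate_bounds:
  fixes f :: "'a::euclidean_space \<Rightarrow> real"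
  assumes conv: "convex_on \<Omega> f" and "open \<Omega>" "x \<in> \<Omega>"
    and lower: "\<And>y. y \<in> \<Omega> \<Longrightarrow> f x + g \<bullet> (y - x) \<le> f y"
    and upper: "\<And>b \<epsilon>. b \<in> Basis \<Longrightarrow> \<epsilon> > 0 \<Longrightarrow>
      \<forall>\<^sub>F s in nhds 0. f (x + s *\<^sub>R b) \<le> f x + s * (g \<bullet> b) + \<epsilon> * \<bar>s\<bar>"
  shows "GDERIV f x :> g"
  unfolding gderiv_def has_derivative_at_alt
proof (intro conjI allI impI)
  show "bounded_linear (\<lambda>h. h \<bullet> g)" by (rule bounded_linear_inner_left)
  fix \<epsilon> :: real assume "\<epsilon> > 0"
  define d where "d = real DIM('a)"
  have "d \<ge> 1"
    using DIM_positive[where 'a='a] by (simp add: d_def Suc_le_eq)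
  have "\<forall>\<^sub>F s in nhds 0. \<forall>b\<in>Basis. f (x + s *\<^sub>R b) \<le> f x + s * (g \<bullet> b) + (\<epsilon> / d) * \<bar>s\<bar>"
    using \<open>\<epsilon> > 0\<close> \<open>d \<ge> 1\<close> by (intro eventually_ball_finite ballI upper) auto
  then obtain \<delta> where "\<delta> > 0" and \<delta>: "\<And>s b. \<bar>s\<bar> < \<delta> \<Longrightarrow> b \<in> Basis \<Longrightarrow>
      f (x + s *\<^sub>R b) \<le> f x + s * (g \<bullet> b) + (\<epsilon> / d) * \<bar>s\<bar>"
    unfolding eventually_nhds_metric dist_real_def by auto
  obtain r where "r > 0" and r: "ball x r \<subseteq> \<Omega>"
    using \<open>open \<Omega>\<close> \<open>x \<in> \<Omega>\<close> open_contains_ball by blast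
  have main: "\<bar>f y - f x - (y - x) \<bullet> g\<bar> \<le> \<epsilon> * norm (y - x)" if y: "norm (y - x) < min \<delta> r / d" for y
  proof -
    define h where "h = y - x"
    have dh: "d * norm h < min \<delta> r"
      using y \<open>d \<ge> 1\<close> by (simp add: h_def field_simps)
    have small: "\<bar>d * (h \<bullet> b)\<bar> < min \<delta> r" if "b \<in> Basis" for b
    proof -
      have "\<bar>d * (h \<bullet> b)\<bar> \<le> d * norm h"
        using Basis_le_norm[OF that, of h] \<open>d \<ge> 1\<close> by (simp add: abs_mult)
      with dh show ?thesis by simp
    qed
    have "norm h \<le> d * norm h" using \<open>d \<ge> 1\<close> by (simp add: mult_le_cancel_right1)
    with dh have "y \<in> \<Omega>" using r by (auto simp: h_def dist_norm norm_minus_commute subset_iff)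
    have y_eq: "y = (\<Sum>b\<in>Basis. (1 / d) *\<^sub>R (x + (d * (h \<bullet> b)) *\<^sub>R b))"
    proof -
      have "(\<Sum>b\<in>Basis. (1 / d) *\<^sub>R (x + (d * (h \<bullet> b)) *\<^sub>R b)) = (\<Sum>b\<in>(Basis::'a set). (1 / d) *\<^sub>R x) + (\<Sum>b\<in>Basis. (h \<bullet> b) *\<^sub>R b)"
        using \<open>d \<ge> 1\<close> by (simp add: scaleR_add_right sum.distrib)
      also have "\<dots> = x + h"
        using \<open>d \<ge> 1\<close> by (simp add: euclidean_representation sum_constant_scaleR d_def)
      finally show ?thesis by (simp add: h_def)
    qed
    have "f y \<le> (\<Sum>b\<in>Basis. (1 / d) * f (x + (d * (h \<bullet> b)) *\<^sub>R b))"
      unfolding y_eq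
    proof (rule convex_on_sum[OF _ _ conv])
      show "x + (d * (h \<bullet> b)) *\<^sub>R b \<in> \<Omega>" if "b \<in> Basis" for b
        using small[OF that] r that by (auto simp: dist_norm subset_iff)
    qed (use \<open>d \<ge> 1\<close> in \<open>auto simp: d_def\<close>)
    also have "\<dots> \<le> (\<Sum>b\<in>Basis. (1 / d) * (f x + (d * (h \<bullet> b)) * (g \<bullet> b) + (\<epsilon> / d) * \<bar>d * (h \<bullet> b)\<bar>))"
      using small \<delta> \<open>d \<ge> 1\<close> by (intro sum_mono mult_left_mono) auto
    also have "\<dots> = (\<Sum>b\<in>Basis. (1 / d) * f x + (h \<bullet> b) * (g \<bullet> b) + (\<epsilon> / d) * \<bar>h \<bullet> b\<bar>)"
      using \<open>d \<ge> 1\<close> by (intro sum.cong) (auto simp: abs_mult field_simps)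
    also have "\<dots> = (\<Sum>b\<in>(Basis::'a set). (1 / d) * f x) + (\<Sum>b\<in>Basis. (h \<bullet> b) * (g \<bullet> b))
        + (\<Sum>b\<in>Basis. (\<epsilon> / d) * \<bar>h \<bullet> b\<bar>)"
      by (simp only: sum.distrib)
    also have "(\<Sum>b\<in>(Basis::'a set). (1 / d) * f x) = f x"
      using \<open>d \<ge> 1\<close> by (simp add: d_def)
    also have "(\<Sum>b\<in>Basis. (h \<bullet> b) * (g \<bullet> b)) = h \<bullet> g"
      by (rule euclidean_inner[symmetric])
    also have "(\<Sum>b\<in>Basis. (\<epsilon> / d) * \<bar>h \<bullet> b\<bar>) \<le> (\<Sum>b\<in>(Basis::'a set). (\<epsilon> / d) * norm h)"
      using \<open>\<epsilon> > 0\<close> \<open>d \<ge> 1\<close> Basis_le_norm by (intro sum_mono mult_left_mono) auto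
    also have "\<dots> = \<epsilon> * norm h"
      using \<open>d \<ge> 1\<close> by (simp add: d_def)
    finally have "f y \<le> f x + h \<bullet> g + \<epsilon> * norm h" by simp
    moreover have "f x + h \<bullet> g \<le> f y"
      using lower[OF \<open>y \<in> \<Omega>\<close>] by (simp add: h_def inner_commute)
    moreover have "0 \<le> \<epsilon> * norm h" using \<open>\<epsilon> > 0\<close> by simp
    ultimately show ?thesis by (simp add: h_def)
  qed
  show "\<exists>\<delta>>0. \<forall>y. norm (y - x) < \<delta> \<longrightarrow> norm (f y - f x - (y - x) \<bullet> g) \<le> \<epsilon> * norm (y - x)"
    using main \<open>\<delta> > 0\<close> \<open>r > 0\<close> \<open>d \<ge> 1\<close> by (intro exI[of _ "min \<delta> r / d"]) auto
qed

section \<open>The saddle function\<close>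

text \<open>A triple \<open>(x, p, c)\<close> stands for the affine function \<open>y \<mapsto> p \<bullet> y - c\<close> attached to the base point
  \<open>x\<close>; the triple \<open>(a, u a, u a \<bullet> a)\<close> encodes \<open>y \<mapsto> u a \<bullet> (y - a)\<close>. Averaging these functions while
  averaging their base points is the same as taking the convex hull of the triples, which avoids
  explicit weights.\<close>

definition minorants :: "'a::real_inner set \<Rightarrow> ('a \<Rightarrow> 'a) \<Rightarrow> ('a \<times> 'a \<times> real) set" where
  "minorants \<Omega> u = convex hull ((\<lambda>a. (a, u a, u a \<bullet> a)) ` \<Omega>)"

text \<open>In the first variable this is the concave hull of \<open>x \<mapsto> u x \<bullet> (y - x)\<close>.\<close>

definition saddle_hull :: "'a::real_inner set \<Rightarrow> ('a \<Rightarrow> 'a) \<Rightarrow> 'a \<Rightarrow> 'a \<Rightarrow> real" where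
  "saddle_hull \<Omega> u x y = (SUP (p, c) \<in> {(p, c). (x, p, c) \<in> minorants \<Omega> u}. p \<bullet> y - c)"

lemma graph_in_minorants: "a \<in> \<Omega> \<Longrightarrow> (a, u a, u a \<bullet> a) \<in> minorants \<Omega> u"
  by (simp add: minorants_def hull_inc)

text \<open>For fixed \<open>y\<close> the inequality defines a half-space of triples. Monotonicity puts the generating
  triples into it, hence also their convex hull.\<close>

lemma minorant_le:
  assumes mono: "monotone_operator_on \<Omega> u" and "(x, p, c) \<in> minorants \<Omega> u" "y \<in> \<Omega>"
  shows "p \<bullet> y - c \<le> u y \<bullet> (y - x)"
proof -
  let ?H = "{w :: 'a \<times> 'a \<times> real. (u y, y, -1) \<bullet> w \<le> u y \<bullet> y}"
  have "convex ?H" by (rule convex_halfspace_le)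
  moreover have "(\<lambda>a. (a, u a, u a \<bullet> a)) ` \<Omega> \<subseteq> ?H"
  proof clarify
    fix a assume "a \<in> \<Omega>"
    then show "(u y, y, -1) \<bullet> (a, u a, u a \<bullet> a) \<le> u y \<bullet> y"
      using monotone_operator_onD[OF mono \<open>y \<in> \<Omega>\<close>, of a]
      by (simp add: algebra_simps inner_commute)
  qed
  ultimately have "minorants \<Omega> u \<subseteq> ?H"
    unfolding minorants_def by (rule hull_minimal[rotated])
  then have "(x, p, c) \<in> ?H" using assms(2) by (rule subsetD)
  then show ?thesis by (simp add: algebra_simps inner_commute)
qed

lemma minorant_le_saddle_hull:
  assumes "monotone_operator_on \<Omega> u" "(x, p, c) \<in> minorants \<Omega> u" "y \<in> \<Omega>"
  shows "p \<bullet> y - c \<le> saddle_hull \<Omega> u x y"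
  unfolding saddle_hull_def
proof (rule cSUP_upper2[where x = "(p, c)"])
  show "bdd_above ((\<lambda>(p, c). p \<bullet> y - c) ` {(p, c). (x, p, c) \<in> minorants \<Omega> u})"
    using minorant_le[OF assms(1) _ assms(3)] by (auto intro!: bdd_aboveI[of _ "u y \<bullet> (y - x)"])
qed (use assms in auto)

lemma saddle_hull_least:
  assumes "x \<in> \<Omega>" "\<And>p c. (x, p, c) \<in> minorants \<Omega> u \<Longrightarrow> p \<bullet> y - c \<le> M"
  shows "saddle_hull \<Omega> u x y \<le> M"
  unfolding saddle_hull_def
  using assms graph_in_minorants[of x \<Omega> u] by (intro cSUP_least) auto

lemma saddle_hull_approx:
  assumes "x \<in> \<Omega>" "\<epsilon> > 0"
  obtains p c where "(x, p, c) \<in> minorants \<Omega> u" "saddle_hull \<Omega> u x y - \<epsilon> < p \<bullet> y - c"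
proof -
  have "\<not> saddle_hull \<Omega> u x y \<le> saddle_hull \<Omega> u x y - \<epsilon>"
    using \<open>\<epsilon> > 0\<close> by simp
  then have "\<exists>p c. (x, p, c) \<in> minorants \<Omega> u \<and> saddle_hull \<Omega> u x y - \<epsilon> < p \<bullet> y - c"
    using saddle_hull_least[OF assms(1), of u y "saddle_hull \<Omega> u x y - \<epsilon>"] by (meson not_le)
  then show ?thesis using that by blast
qed

lemma saddle_hull_bounds:
  assumes "monotone_operator_on \<Omega> u" "x \<in> \<Omega>" "y \<in> \<Omega>"
  shows "u x \<bullet> (y - x) \<le> saddle_hull \<Omega> u x y" "saddle_hull \<Omega> u x y \<le> u y \<bullet> (y - x)"
proof -
  show "u x \<bullet> (y - x) \<le> saddle_hull \<Omega> u x y"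
    using minorant_le_saddle_hull[OF assms(1) graph_in_minorants[OF \<open>x \<in> \<Omega>\<close>] \<open>y \<in> \<Omega>\<close>]
    by (simp add: inner_diff_right)
  show "saddle_hull \<Omega> u x y \<le> u y \<bullet> (y - x)"
    using minorant_le[OF assms(1) _ \<open>y \<in> \<Omega>\<close>] \<open>x \<in> \<Omega>\<close> by (rule saddle_hull_least[rotated])
qed

lemma saddle_hull_diagonal:
  assumes "monotone_operator_on \<Omega> u" "x \<in> \<Omega>"
  shows "saddle_hull \<Omega> u x x = 0"
  using saddle_hull_bounds[OF assms(1) \<open>x \<in> \<Omega>\<close> \<open>x \<in> \<Omega>\<close>] by simp

text \<open>Concavity holds because an average of minorants attached to \<open>v\<close> and \<open>w\<close> is attached to the
  average of \<open>v\<close> and \<open>w\<close>; convexity because each minorant is affine in \<open>y\<close>.\<close>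

lemma saddle_hull_concave_convex:
  assumes mono: "monotone_operator_on \<Omega> u" and "convex \<Omega>"
  shows "concave_convex_on \<Omega> (saddle_hull \<Omega> u)"
  unfolding concave_convex_on_def
proof (intro conjI ballI)
  fix y assume "y \<in> \<Omega>"
  show "concave_on \<Omega> (\<lambda>x. saddle_hull \<Omega> u x y)"
    unfolding concave_on_iff
  proof (intro conjI ballI allI impI)
    fix v w and a b :: real
    assume "v \<in> \<Omega>" "w \<in> \<Omega>" "0 \<le> a" "0 \<le> b" "a + b = 1"
    show "a * saddle_hull \<Omega> u v y + b * saddle_hull \<Omega> u w y \<le> saddle_hull \<Omega> u (a *\<^sub>R v + b *\<^sub>R w) y"
    proof (rule field_le_epsilon)
      fix \<epsilon> :: real assume "\<epsilon> > 0"
      obtain p c where p: "(v, p, c) \<in> minorants \<Omega> u" "saddle_hull \<Omega> u v y - \<epsilon> < p \<bullet> y - c"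
        using saddle_hull_approx[OF \<open>v \<in> \<Omega>\<close> \<open>\<epsilon> > 0\<close>] .
      obtain q e where q: "(w, q, e) \<in> minorants \<Omega> u" "saddle_hull \<Omega> u w y - \<epsilon> < q \<bullet> y - e"
        using saddle_hull_approx[OF \<open>w \<in> \<Omega>\<close> \<open>\<epsilon> > 0\<close>] .
      have "a *\<^sub>R (v, p, c) + b *\<^sub>R (w, q, e) \<in> minorants \<Omega> u"
        using p q \<open>0 \<le> a\<close> \<open>0 \<le> b\<close> \<open>a + b = 1\<close> unfolding minorants_def
        by (intro convexD convex_convex_hull)
      then have "(a *\<^sub>R p + b *\<^sub>R q) \<bullet> y - (a * c + b * e) \<le> saddle_hull \<Omega> u (a *\<^sub>R v + b *\<^sub>R w) y"
        using \<open>y \<in> \<Omega>\<close> by (intro minorant_le_saddle_hull[OF mono]) auto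
      moreover have "a * (saddle_hull \<Omega> u v y - \<epsilon>) + b * (saddle_hull \<Omega> u w y - \<epsilon>)
          \<le> a * (p \<bullet> y - c) + b * (q \<bullet> y - e)"
        using p q \<open>0 \<le> a\<close> \<open>0 \<le> b\<close> by (intro add_mono mult_left_mono) auto
      moreover have "a * \<epsilon> + b * \<epsilon> = \<epsilon>"
        using \<open>a + b = 1\<close> by (simp flip: distrib_right)
      ultimately show "a * saddle_hull \<Omega> u v y + b * saddle_hull \<Omega> u w y
          \<le> saddle_hull \<Omega> u (a *\<^sub>R v + b *\<^sub>R w) y + \<epsilon>"
        by (simp add: algebra_simps)
    qed
  qed (fact \<open>convex \<Omega>\<close>)
next
  fix x assume "x \<in> \<Omega>"
  show "convex_on \<Omega> (saddle_hull \<Omega> u x)"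
    unfolding convex_on_def
  proof (intro conjI ballI allI impI)
    fix v w and a b :: real
    assume "v \<in> \<Omega>" "w \<in> \<Omega>" "0 \<le> a" "0 \<le> b" "a + b = 1"
    show "saddle_hull \<Omega> u x (a *\<^sub>R v + b *\<^sub>R w) \<le> a * saddle_hull \<Omega> u x v + b * saddle_hull \<Omega> u x w"
    proof (rule saddle_hull_least[OF \<open>x \<in> \<Omega>\<close>])
      fix p c assume pc: "(x, p, c) \<in> minorants \<Omega> u"
      have "p \<bullet> (a *\<^sub>R v + b *\<^sub>R w) - c = p \<bullet> (a *\<^sub>R v + b *\<^sub>R w) - (a + b) * c"
        using \<open>a + b = 1\<close> by simp
      also have "\<dots> = a * (p \<bullet> v - c) + b * (p \<bullet> w - c)"
        by (simp add: algebra_simps)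
      also have "\<dots> \<le> a * saddle_hull \<Omega> u x v + b * saddle_hull \<Omega> u x w"
        using \<open>0 \<le> a\<close> \<open>0 \<le> b\<close> minorant_le_saddle_hull[OF mono pc] \<open>v \<in> \<Omega>\<close> \<open>w \<in> \<Omega>\<close>
        by (intro add_mono mult_left_mono) auto
      finally show "p \<bullet> (a *\<^sub>R v + b *\<^sub>R w) - c \<le> a * saddle_hull \<Omega> u x v + b * saddle_hull \<Omega> u x w" .
    qed
  qed (fact \<open>convex \<Omega>\<close>)
qed

text \<open>Near-optimal minorants \<open>(x i, p i, c i)\<close> for the pairs \<open>(x i, x (i + 1))\<close> reduce the claim to a
  cyclic sum over triples in a convex hull. On the generating triples this sum is the one in the
  definition of cyclic monotonicity, with the opposite sign.\<close>

lemma saddle_hull_cyclically_sub_antisymmetric: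
  assumes "N \<ge> 2" and cyc: "cyclically_monotone_on N \<Omega> u"
  shows "cyclically_sub_antisymmetric_on N \<Omega> (saddle_hull \<Omega> u)"
  unfolding cyclically_sub_antisymmetric_on_def
proof (intro conjI ballI allI impI)
  have mono: "monotone_operator_on \<Omega> u"
    using assms by (rule cyclically_monotone_imp_monotone_operator)
  show "saddle_hull \<Omega> u x x = 0" if "x \<in> \<Omega>" for x
    using mono that by (rule saddle_hull_diagonal)
  fix x :: "nat \<Rightarrow> 'a" assume "(\<forall>i\<in>{1..N}. x i \<in> \<Omega>) \<and> x (N + 1) = x 1"
  then have x: "\<forall>i\<in>{1..N}. x i \<in> \<Omega>" and closed: "x (N + 1) = x 1" by auto
  \<comment> \<open>The successor on the cycle \<open>{1..N}\<close>; it has no fixed point because \<open>N \<ge> 2\<close>.\<close>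
  define s where "s i = (if i = N then 1 else i + 1)" for i :: nat
  define B where "B v w = fst (snd v) \<bullet> fst w - snd (snd v)" for v w :: "'a \<times> 'a \<times> real"
  have xs: "x (i + 1) = x (s i)" for i
    using closed by (simp add: s_def)
  show "(\<Sum>i = 1..N. saddle_hull \<Omega> u (x i) (x (i + 1))) \<le> 0"
  proof (rule field_le_epsilon)
    fix \<epsilon> :: real assume "\<epsilon> > 0"
    then have "\<epsilon> / N > 0" using \<open>N \<ge> 2\<close> by simp
    have "\<forall>i\<in>{1..N}. \<exists>q. (x i, fst q, snd q) \<in> minorants \<Omega> u \<and>
        saddle_hull \<Omega> u (x i) (x (i + 1)) - \<epsilon> / N < fst q \<bullet> x (i + 1) - snd q"
    proof
      fix i assume "i \<in> {1..N}"
      then have "x i \<in> \<Omega>" using x by blast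
      obtain p c where "(x i, p, c) \<in> minorants \<Omega> u"
        "saddle_hull \<Omega> u (x i) (x (i + 1)) - \<epsilon> / N < p \<bullet> x (i + 1) - c"
        using saddle_hull_approx[OF \<open>x i \<in> \<Omega>\<close> \<open>\<epsilon> / N > 0\<close>] .
      then show "\<exists>q. (x i, fst q, snd q) \<in> minorants \<Omega> u \<and>
          saddle_hull \<Omega> u (x i) (x (i + 1)) - \<epsilon> / N < fst q \<bullet> x (i + 1) - snd q"
        by (intro exI[of _ "(p, c)"]) simp
    qed
    from bchoice[OF this] obtain q where q: "\<forall>i\<in>{1..N}. (x i, fst (q i), snd (q i)) \<in> minorants \<Omega> u \<and>
        saddle_hull \<Omega> u (x i) (x (i + 1)) - \<epsilon> / N < fst (q i) \<bullet> x (i + 1) - snd (q i)"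
      by blast
    define p where "p i = fst (q i)" for i
    define c where "c i = snd (q i)" for i
    have pc: "(x i, p i, c i) \<in> minorants \<Omega> u"
      "saddle_hull \<Omega> u (x i) (x (i + 1)) - \<epsilon> / N < p i \<bullet> x (i + 1) - c i" if "i \<in> {1..N}" for i
      using q that unfolding p_def c_def by blast+
    define z where "z i = (x i, p i, c i)" for i
    have "(\<Sum>i = 1..N. B (z i) (z (s i))) \<le> 0"
    proof (rule cyclic_sum_nonpos_convex_hull[where B = B and z = z and s = s
          and G = "(\<lambda>a. (a, u a, u a \<bullet> a)) ` \<Omega>"])
      show "s i \<noteq> i" if "i \<in> {1..N}" for i
        using \<open>N \<ge> 2\<close> by (simp add: s_def)
      show "z i \<in> convex hull ((\<lambda>a. (a, u a, u a \<bullet> a)) ` \<Omega>)" if "i \<in> {1..N}" for i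
        using pc(1)[OF that] by (simp add: z_def minorants_def)
      show "B (a *\<^sub>R v + b *\<^sub>R w) z = a * B v z + b * B w z" if "a + b = 1" for a b v w z
        by (simp add: B_def algebra_simps)
      show "B z (a *\<^sub>R v + b *\<^sub>R w) = a * B z v + b * B z w" if "a + b = 1" for a b v w z
      proof -
        have "B z (a *\<^sub>R v + b *\<^sub>R w) = fst (snd z) \<bullet> fst (a *\<^sub>R v + b *\<^sub>R w) - (a + b) * snd (snd z)"
          using that by (simp add: B_def)
        also have "\<dots> = a * B z v + b * B z w"
          by (simp add: B_def algebra_simps)
        finally show ?thesis .
      qed
      fix z assume z: "\<And>i. i \<in> {1..N} \<Longrightarrow> z i \<in> (\<lambda>a. (a, u a, u a \<bullet> a)) ` \<Omega>"
      \<comment> \<open>The index \<open>N + 1\<close> is redirected to \<open>1\<close>, which closes the cycle of base points.\<close>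
      define a where "a i = fst (z (if i = N + 1 then 1 else i))" for i
      have a: "a i \<in> \<Omega>" "z i = (a i, u (a i), u (a i) \<bullet> a i)" if "i \<in> {1..N}" for i
        using z[OF that] that by (auto simp: a_def)
      have s_mem: "s i \<in> {1..N}" if "i \<in> {1..N}" for i
        using that by (auto simp: s_def)
      have "a (N + 1) = a 1" using \<open>N \<ge> 2\<close> by (simp add: a_def)
      then have as: "a (s i) = a (i + 1)" for i by (simp add: s_def)
      have "(\<Sum>i = 1..N. u (a i) \<bullet> (a i - a (i + 1))) \<ge> 0"
        using cyc a(1) \<open>a (N + 1) = a 1\<close> unfolding cyclically_monotone_on_def by blast
      moreover have "(\<Sum>i = 1..N. B (z i) (z (s i))) = (\<Sum>i = 1..N. - (u (a i) \<bullet> (a i - a (i + 1))))"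
      proof (rule sum.cong)
        fix i assume "i \<in> {1..N}"
        from a(2)[OF this] a(2)[OF s_mem[OF this]]
        show "B (z i) (z (s i)) = - (u (a i) \<bullet> (a i - a (i + 1)))"
          unfolding as by (simp add: B_def inner_diff_right)
      qed simp
      ultimately show "(\<Sum>i = 1..N. B (z i) (z (s i))) \<le> 0"
        by (simp add: sum_negf)
    qed simp
    moreover have "B (z i) (z (s i)) = p i \<bullet> x (i + 1) - c i" for i
      by (simp add: B_def z_def flip: xs)
    moreover have "(\<Sum>i = 1..N. saddle_hull \<Omega> u (x i) (x (i + 1))) \<le> (\<Sum>i = 1..N. (p i \<bullet> x (i + 1) - c i) + \<epsilon> / N)"
      using pc(2) by (intro sum_mono) (simp add: less_imp_le algebra_simps)
    moreover have "\<dots> = (\<Sum>i = 1..N. p i \<bullet> x (i + 1) - c i) + \<epsilon>"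
      using \<open>N \<ge> 2\<close> by (simp add: sum.distrib)
    ultimately show "(\<Sum>i = 1..N. saddle_hull \<Omega> u (x i) (x (i + 1))) \<le> 0 + \<epsilon>"
      by simp
  qed
qed

lemma saddle_hull_subdifferential:
  assumes mono: "monotone_operator_on \<Omega> u" and "x \<in> \<Omega>"
  shows "(- u x, u x) \<in> saddle_subdifferential \<Omega> (saddle_hull \<Omega> u) x x"
  unfolding saddle_subdifferential_def
  using saddle_hull_bounds[OF mono _ \<open>x \<in> \<Omega>\<close>] saddle_hull_bounds[OF mono \<open>x \<in> \<Omega>\<close>]
    saddle_hull_diagonal[OF mono \<open>x \<in> \<Omega>\<close>]
  by (auto simp: inner_diff_right)

text \<open>The upper bound \<open>u y \<bullet> (y - x)\<close> at \<open>y = x + s *\<^sub>R b\<close> differs from the lower bound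
  \<open>s * (u x \<bullet> b)\<close> by \<open>s\<close> times the increment of \<open>u \<bullet> b\<close> along the line, which continuity makes
  small.\<close>

lemma saddle_hull_gradient:
  fixes u :: "'a::euclidean_space \<Rightarrow> 'a"
  assumes mono: "monotone_operator_on \<Omega> u" and "open \<Omega>" "convex \<Omega>" "x \<in> \<Omega>"
    and cont: "\<And>b. b \<in> Basis \<Longrightarrow> isCont (\<lambda>t. u (x + t *\<^sub>R b) \<bullet> b) 0"
  shows "GDERIV (saddle_hull \<Omega> u x) x :> u x"
proof (rule convex_has_derivative_of_coordinate_bounds)
  show "convex_on \<Omega> (saddle_hull \<Omega> u x)"
    using saddle_hull_concave_convex[OF mono \<open>convex \<Omega>\<close>] \<open>x \<in> \<Omega>\<close> by (simp add: concave_convex_on_def)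
  have diag: "saddle_hull \<Omega> u x x = 0"
    using mono \<open>x \<in> \<Omega>\<close> by (rule saddle_hull_diagonal)
  show "saddle_hull \<Omega> u x x + u x \<bullet> (y - x) \<le> saddle_hull \<Omega> u x y" if "y \<in> \<Omega>" for y
    using saddle_hull_bounds(1)[OF mono \<open>x \<in> \<Omega>\<close> that] diag by simp
  fix b :: 'a and \<epsilon> :: real assume "b \<in> Basis" "\<epsilon> > 0"
  have "\<forall>\<^sub>F s in nhds 0. dist (u (x + s *\<^sub>R b) \<bullet> b) (u (x + 0 *\<^sub>R b) \<bullet> b) < \<epsilon>"
    using cont[OF \<open>b \<in> Basis\<close>] \<open>\<epsilon> > 0\<close>
    by (simp add: continuous_at_eps_delta eventually_nhds_metric)
  moreover have "\<forall>\<^sub>F s in nhds 0. x + s *\<^sub>R b \<in> \<Omega>"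
  proof -
    have "((\<lambda>s. x + s *\<^sub>R b) \<longlongrightarrow> x + 0 *\<^sub>R b) (nhds 0)"
      by (intro tendsto_intros filterlim_ident)
    then show ?thesis
      using topological_tendstoD[OF _ \<open>open \<Omega>\<close>] \<open>x \<in> \<Omega>\<close> by fastforce
  qed
  ultimately show "\<forall>\<^sub>F s in nhds 0. saddle_hull \<Omega> u x (x + s *\<^sub>R b) \<le> saddle_hull \<Omega> u x x + s * (u x \<bullet> b) + \<epsilon> * \<bar>s\<bar>"
  proof eventually_elim
    case (elim s)
    have "saddle_hull \<Omega> u x (x + s *\<^sub>R b) \<le> u (x + s *\<^sub>R b) \<bullet> (s *\<^sub>R b)"
      using saddle_hull_bounds(2)[OF mono \<open>x \<in> \<Omega>\<close> elim(2)] by simp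
    also have "\<dots> = s * (u x \<bullet> b) + s * (u (x + s *\<^sub>R b) \<bullet> b - u x \<bullet> b)"
      by (simp add: algebra_simps)
    also have "s * (u (x + s *\<^sub>R b) \<bullet> b - u x \<bullet> b) \<le> \<bar>s\<bar> * \<bar>u (x + s *\<^sub>R b) \<bullet> b - u x \<bullet> b\<bar>"
      by (metis abs_ge_self abs_mult)
    also have "\<dots> \<le> \<bar>s\<bar> * \<epsilon>"
      using elim(1) by (intro mult_left_mono) (auto simp: dist_real_def)
    finally show ?case by (simp add: diag mult.commute)
  qed
qed (fact assms)+

section \<open>The variational representation\<close>

theorem theorem5:
  fixes N :: nat and \<Omega> :: "(real ^ 'd) set" and u :: "real ^ 'd \<Rightarrow> real ^ 'd"
  assumes "N \<ge> 2"
    and "\<Omega> \<noteq> {}" and "open \<Omega>" and "connected \<Omega>" and "convex \<Omega>"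
    and "cyclically_monotone_on N \<Omega> u"
  shows "\<exists>F :: real ^ 'd \<Rightarrow> real ^ 'd \<Rightarrow> real.
           concave_convex_on \<Omega> F \<and>
           cyclically_sub_antisymmetric_on N \<Omega> F \<and>
           (\<forall>x\<in>\<Omega>. F x x = 0) \<and>
           (\<forall>x\<in>\<Omega>. (- u x, u x) \<in> saddle_subdifferential \<Omega> F x x) \<and>
           (AE x in lebesgue. x \<in> \<Omega> \<longrightarrow> (GDERIV (\<lambda>y. F x y) x :> u x))"
proof -
  have mono: "monotone_operator_on \<Omega> u"
    using assms by (intro cyclically_monotone_imp_monotone_operator)
  have "AE x in lborel. \<forall>b\<in>Basis. x \<in> \<Omega> \<longrightarrow> isCont (\<lambda>t. u (x + t *\<^sub>R b) \<bullet> b) 0"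
    using monotone_operator_continuous_along_line_AE[OF mono \<open>open \<Omega>\<close> \<open>convex \<Omega>\<close>]
    by (intro AE_finite_allI) auto
  then have "AE x in lebesgue. \<forall>b\<in>Basis. x \<in> \<Omega> \<longrightarrow> isCont (\<lambda>t. u (x + t *\<^sub>R b) \<bullet> b) 0"
    by (rule AE_completion)
  then have "AE x in lebesgue. x \<in> \<Omega> \<longrightarrow> (GDERIV (saddle_hull \<Omega> u x) x :> u x)"
    by eventually_elim (use saddle_hull_gradient[OF mono \<open>open \<Omega>\<close> \<open>convex \<Omega>\<close>] in blast)
  then show ?thesis
    using saddle_hull_concave_convex[OF mono \<open>convex \<Omega>\<close>]
      saddle_hull_cyclically_sub_antisymmetric[OF \<open>N \<ge> 2\<close> \<open>cyclically_monotone_on N \<Omega> u\<close>]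
      saddle_hull_diagonal[OF mono] saddle_hull_subdifferential[OF mono]
    by (intro exI[of _ "saddle_hull \<Omega> u"]) auto
qed

end
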